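(* Let $G$ be an orderly topological group. Then the neutral element is the only weakly topologically torsion element in $G$.
   Context: An element $g$ of a topological group $G$ with neutral element $e$ is weakly topologically torsion if $e$ belongs to the closure in $G$ of the set $\{g^n: n\in\mathbb{N}\}$, where $\mathbb{N}=\{1,2,\dots\}$. The interval topology of a linearly ordered set has as subbase all rays $\{x: a<x\}$, $\{x: x<b\}$. A compact linearly ordered space is a linearly ordered set whose interval topology is compact, equipped with that topology. $H_+(K)$ is the group of all order-preserving homeomorphisms $K\to K$ with the compact-open topology. A topological group is orderly if it embeds as a topological group (injective homomorphism, homeomorphism onto its image) into $H_+(K)$ for some compact linearly ordered space $K$. *)

theory Defs
  imports "HOL-Analysis.Analysis" "HOL-Algebra.Elementary_Groups"
begin

locale topological_group = group G for G (structure) +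
  fixes T :: "'a topology"
  assumes topspace_eq_carrier: "topspace T = carrier G"
    and continuous_mult: "continuous_map (prod_topology T T) T (\<lambda>(x, y). x \<otimes> y)"
    and continuous_inv: "continuous_map T T (\<lambda>x. inv x)"

definition weakly_topologically_torsion ::
    "('a, 'b) monoid_scheme \<Rightarrow> 'a topology \<Rightarrow> 'a \<Rightarrow> bool" where
  "weakly_topologically_torsion G T g \<longleftrightarrow>
     \<one>\<^bsub>G\<^esub> \<in> T closure_of {g [^]\<^bsub>G\<^esub> n | n::nat. n \<ge> 1}"

text \<open>
  A compact linearly ordered space is modelled as a type \<open>'k\<close> of class
  \<^class>\<open>linorder_topology\<close> (whose topology is by definition the interval topology)
  such that the whole type is compact.
\<close>

definition H_plus_set :: "('k::linorder_topology \<Rightarrow> 'k) set" where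
  "H_plus_set = {f. mono f \<and> (\<exists>f'. homeomorphism UNIV UNIV f f')}"

definition H_plus :: "('k::linorder_topology \<Rightarrow> 'k) monoid" where
  "H_plus = \<lparr>carrier = H_plus_set, mult = (\<circ>), one = id\<rparr>"

text \<open>
  The subbasic sets below cover \<open>F\<close> (take \<open>C = {}\<close>), so \<open>F\<close> is the underlying set of this topology.
\<close>

definition compact_open_topology ::
    "('x::topological_space \<Rightarrow> 'y::topological_space) set \<Rightarrow> ('x \<Rightarrow> 'y) topology" where
  "compact_open_topology F =
     topology_generated_by {{f \<in> F. f ` C \<subseteq> U} | C U. compact C \<and> open U}"

text \<open>
  HOL cannot quantify existentially over types, so the type \<open>'k\<close> carrying the space \<open>K\<close> is an
  explicit parameter. A theorem assuming \<open>orderly TYPE('k) G T\<close> for a type variable \<open>'k\<close> holds for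
  every choice of \<open>K\<close>, which is what a hypothesis ``for some \<open>K\<close>'' amounts to. Types being nonempty
  loses nothing: for empty \<open>K\<close> the group is trivial, as it is for a one-point \<open>K\<close>.
\<close>

definition orderly ::
    "'k::linorder_topology itself \<Rightarrow> ('a, 'b) monoid_scheme \<Rightarrow> 'a topology \<Rightarrow> bool" where
  "orderly _ G T \<longleftrightarrow>
     compact (UNIV :: 'k set) \<and>
     (\<exists>\<phi> :: 'a \<Rightarrow> 'k \<Rightarrow> 'k. \<phi> \<in> mon G H_plus \<and>
        embedding_map T (compact_open_topology H_plus_set) \<phi>)"

end

theory Submission
  imports Defs
begin

text \<open>
  Suppose the image \<open>f\<close> of \<open>g\<close> in \<open>H\<^sub>+(K)\<close> moves a point \<open>x\<close>. Monotonicity keeps all iterates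
  \<open>f\<^sup>n(x)\<close> with \<open>n \<ge> 1\<close> on the far side of \<open>f(x)\<close>, so the maps sending \<open>x\<close> into the open ray that
  contains \<open>x\<close> and is bounded by \<open>f(x)\<close> form a neighbourhood of the identity containing no
  positive power of \<open>f\<close>.
\<close>

text \<open>The bound has to be \<open>f x\<close> and not just \<open>x\<close>: later
  \<open>f x\<close> is the excluded endpoint of an open ray around \<open>x\<close> that all the
  iterates avoid.\<close>

lemma mono_funpow_ge:
  fixes f :: "'k::order \<Rightarrow> 'k"
  assumes "mono f" "x \<le> f x" "n \<ge> 1"
  shows "f x \<le> (f ^^ n) x"
  using \<open>n \<ge> 1\<close>
proof (induction n rule: dec_induct)
  case (step n)
  \<comment> \<open>Applying the monotone \<open>f\<close> to this weaker bound gives the bound by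
    \<open>f x\<close> for the next iterate.\<close>
  then have "x \<le> (f ^^ n) x"
    using \<open>x \<le> f x\<close> by order
  then show ?case
    using \<open>mono f\<close> by (simp add: monoD)
qed simp

lemma mono_funpow_le:
  fixes f :: "'k::order \<Rightarrow> 'k"
  assumes "mono f" "f x \<le> x" "n \<ge> 1"
  shows "(f ^^ n) x \<le> f x"
  using \<open>n \<ge> 1\<close>
proof (induction n rule: dec_induct)
  case (step n)
  then have "(f ^^ n) x \<le> x"
    using \<open>f x \<le> x\<close> by order
  then show ?case
    using \<open>mono f\<close> by (simp add: monoD)
qed simp

lemma mono_moved_point_open:
  fixes f :: "'k::linorder_topology \<Rightarrow> 'k"
  assumes "mono f" "f x \<noteq> x"
  obtains U where "open U" "x \<in> U" "\<And>n. n \<ge> 1 \<Longrightarrow> (f ^^ n) x \<notin> U"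
proof (cases "x < f x")
  case True
  then show thesis
    using that[of "{..<f x}"] mono_funpow_ge[OF \<open>mono f\<close>, of x] by (auto simp: not_less)
next
  case False
  then show thesis
    using that[of "{f x<..}"] mono_funpow_le[OF \<open>mono f\<close>, of x] \<open>f x \<noteq> x\<close>
    by (auto simp: not_less)
qed

lemma H_plus_set_injD:
  assumes "f \<in> H_plus_set" "f x = f y"
  shows "x = y"
proof -
  obtain f' where "\<And>z. f' (f z) = z"
    using assms(1) by (auto simp: H_plus_set_def homeomorphism_def)
  then show ?thesis
    using assms(2) by metis
qed

context group
begin

text \<open>Membership in \<open>hom\<close> only demands that products be preserved, and
  \<open>H_plus\<close> has not been shown to be a group. But the image of the neutral element is
  idempotent, and an idempotent injective map is the identity.\<close>

lemma hom_H_plus_one: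
  assumes "\<phi> \<in> hom G H_plus"
  shows "\<phi> \<one> = id"
proof
  fix x
  have "\<phi> \<one> \<in> H_plus_set"
    using hom_in_carrier[OF assms one_closed] by (simp add: H_plus_def)
  moreover have "\<phi> \<one> \<circ> \<phi> \<one> = \<phi> \<one>"
    using hom_mult[OF assms one_closed one_closed] by (simp add: H_plus_def)
  then have "\<phi> \<one> (\<phi> \<one> x) = \<phi> \<one> x"
    by (simp add: fun_eq_iff)
  ultimately have "\<phi> \<one> x = x"
    by (rule H_plus_set_injD)
  then show "\<phi> \<one> x = id x"
    by simp
qed

lemma hom_H_plus_pow:
  fixes n :: nat
  assumes "\<phi> \<in> hom G H_plus" "g \<in> carrier G"
  shows "\<phi> (g [^] n) = \<phi> g ^^ n"
proof (induction n)
  case 0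
  then show ?case
    using hom_H_plus_one[OF assms(1)] by (simp add: id_def)
next
  case (Suc n)
  then show ?case
    \<comment> \<open>Powers in \<open>G\<close> grow by a factor \<open>g\<close> on the right, so
      the iterate is split with its extra factor on the right as well.\<close>
    using hom_mult[OF assms(1), of "g [^] n" g] assms(2)
    by (simp add: H_plus_def funpow_Suc_right del: funpow.simps)
qed

lemma weakly_topologically_torsion_H_plus:
  fixes \<phi> :: "'a \<Rightarrow> 'k::linorder_topology \<Rightarrow> 'k"
  assumes \<phi>: "\<phi> \<in> hom G H_plus"
    and cont: "continuous_map T (compact_open_topology H_plus_set) \<phi>"
    and g: "g \<in> carrier G" "weakly_topologically_torsion G T g"
  shows "\<phi> g = id"
proof (rule ccontr)
  assume "\<phi> g \<noteq> id"
  then obtain x where x: "\<phi> g x \<noteq> x"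
    by (auto simp: fun_eq_iff)
  have im: "\<phi> h \<in> H_plus_set" if "h \<in> carrier G" for h
    using hom_in_carrier[OF \<phi> that] by (simp add: H_plus_def)
  then have "mono (\<phi> g)"
    using g(1) by (auto simp: H_plus_set_def)
  then obtain U where U: "open U" "x \<in> U" "\<And>n. n \<ge> 1 \<Longrightarrow> (\<phi> g ^^ n) x \<notin> U"
    using mono_moved_point_open[of "\<phi> g" x] x by blast
  \<comment> \<open>The compact set \<open>{x}\<close> makes this condition on the value at
    \<open>x\<close> a subbasic open set.\<close>
  define W where "W = {f \<in> H_plus_set. f ` {x} \<subseteq> U}"
  have "openin (compact_open_topology H_plus_set) W"
    unfolding compact_open_topology_def W_def
    by (intro topology_generated_by_Basis CollectI exI[of _ "{x}"] exI[of _ U] conjI refl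
        compact_sing U(1))
  then have V: "openin T {h \<in> topspace T. \<phi> h \<in> W}" (is "openin T ?V")
    by (rule openin_continuous_map_preimage[OF cont])
  have one: "\<one> \<in> T closure_of {g [^] n | n::nat. n \<ge> 1}" (is "_ \<in> T closure_of ?S")
    using g(2) by (simp only: weakly_topologically_torsion_def)
  \<comment> \<open>That \<open>\<one>\<close> lies in \<open>topspace T\<close> comes from its
    membership in a closure; \<open>T\<close> is not tied to the carrier here.\<close>
  have "\<one> \<in> ?V"
    using one U(2) im[OF one_closed] hom_H_plus_one[OF \<phi>]
    by (simp add: in_closure_of W_def)
  then have "\<one> \<in> ?V \<inter> T closure_of ?S"
    using one by (rule IntI)
  then have "?V \<inter> T closure_of ?S \<noteq> {}"
    by (metis emptyE)
  then have "?V \<inter> ?S \<noteq> {}"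
    by (simp only: openin_Int_closure_of_eq_empty[OF V] not_False_eq_True)
  then obtain h where "h \<in> ?S" "h \<in> ?V"
    by blast
  then obtain n :: nat where "n \<ge> 1" "\<phi> (g [^] n) \<in> W"
    by auto
  then show False
    using U(3)[of n] hom_H_plus_pow[OF \<phi> g(1), of n] by (simp add: W_def)
qed

end

theorem proposition4p4:
  fixes G :: "('a, 'b) monoid_scheme" and T :: "'a topology"
  assumes "topological_group G T"
    and "orderly TYPE('k::linorder_topology) G T"
  shows "{g \<in> carrier G. weakly_topologically_torsion G T g} = {\<one>\<^bsub>G\<^esub>}"
proof -
  interpret topological_group G T
    by fact
  obtain \<phi> :: "'a \<Rightarrow> 'k \<Rightarrow> 'k" where \<phi>: "\<phi> \<in> hom G H_plus" "inj_on \<phi> (carrier G)"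
    and cont: "continuous_map T (compact_open_topology H_plus_set) \<phi>"
  proof -
    obtain \<phi> :: "'a \<Rightarrow> 'k \<Rightarrow> 'k" where "\<phi> \<in> mon G H_plus"
      and "embedding_map T (compact_open_topology H_plus_set) \<phi>"
      using assms(2) unfolding orderly_def by blast
    \<comment> \<open>An embedding is a homeomorphism onto its image with the subspace topology;
      continuity passes from there to the full topology.\<close>
    then show thesis
      using that[of \<phi>] homeomorphic_imp_continuous_map[of T _ \<phi>] continuous_map_into_fulltopology
      unfolding mon_def embedding_map_def by blast
  qed
  have "g = \<one>\<^bsub>G\<^esub>" if "g \<in> carrier G" "weakly_topologically_torsion G T g" for g
  proof (rule inj_onD[OF \<phi>(2)])
    show "\<phi> g = \<phi> \<one>\<^bsub>G\<^esub>"
      using weakly_topologically_torsion_H_plus[OF \<phi>(1) cont that] hom_H_plus_one[OF \<phi>(1)] by simp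
  qed (use that in auto)
  moreover have "weakly_topologically_torsion G T \<one>\<^bsub>G\<^esub>"
  proof -
    \<comment> \<open>Exponent 0 is excluded, so the witness is \<open>n = 1\<close>.\<close>
    have "\<one>\<^bsub>G\<^esub> \<in> {\<one>\<^bsub>G\<^esub> [^]\<^bsub>G\<^esub> n | n::nat. n \<ge> 1}"
      by (simp add: exI[of _ "1::nat"])
    then show ?thesis
      unfolding weakly_topologically_torsion_def in_closure_of topspace_eq_carrier
      using one_closed by blast
  qed
  ultimately show ?thesis
    by blast
qed

end
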